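(* Let $N\geq 3$ be an integer, and let $p>1$, $q\geq 1$, $\alpha\geq 0$ and $-1<\varrho\leq 0$ be real numbers. Set $\delta=\alpha\left(1-\frac1q\right)$ and suppose that $\delta<\frac{2}{N}$. Assume that $\mathbf{w}\in C(\mathbb{R}^N)\cap L^1(\mathbb{R}^N)$ satisfies both $$\inf_{\lambda>0,\;x\in\mathbb{R}^N}\left(\int_{\mathbb{R}^N}e^{-\frac{|x-y|^2}{\lambda}}\,\mathbf{w}(y)\,dy\right)\geq 0\qquad\text{and}\qquad \int_{\mathbb{R}^N}\mathbf{w}(x)\,dx>0 .$$ If $$p+\frac{N\delta}{N-2\varrho-2}<\frac{N-2\varrho}{N-2\varrho-2},$$ then the problem $$\partial_t u-\Delta u=\|u(t)\|_q^{\alpha}|u|^p+t^{\varrho}\,\mathbf{w}(x)\ \text{ in }\mathbb{R}^N\times(0,\infty),\qquad u(x,0)=u_0(x)\ \text{ in }\mathbb{R}^N,$$ admits no global weak solution with nonnegative initial data $u_0$.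
   Context: Here $\|u(t)\|_q=\|u(\cdot,t)\|_{L^q(\mathbb{R}^N)}$. A function $u$ is called a global weak solution of the problem with initial data $u_0$ if $$u_0\in L^1(\mathbb{R}^N),\qquad u\in L^\infty_{loc}((0,\infty),L^q(\mathbb{R}^N)),\qquad \|u(t)\|_q^{\alpha}|u|^p\in L^1_{loc}(\mathbb{R}^N\times(0,\infty)),$$ and $$\int_{\mathbb{R}^N\times(0,\infty)}u(-\partial_t\psi-\Delta\psi)\,dx\,dt=\int_{\mathbb{R}^N}u_0(x)\psi(x,0)\,dx+\int_{\mathbb{R}^N\times(0,\infty)}\|u(t)\|_q^{\alpha}|u|^p\psi\,dx\,dt+\int_{\mathbb{R}^N\times(0,\infty)}t^{\varrho}\,\mathbf{w}\,\psi\,dx\,dt$$ for all $\psi\in C_0^\infty(\mathbb{R}^N\times[0,\infty))$. *)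

theory Defs
  imports "HOL-Analysis.Analysis"
begin

definition Lq_norm :: "real \<Rightarrow> ('a::euclidean_space \<Rightarrow> real) \<Rightarrow> real" where
  "Lq_norm q f = (LINT x|lebesgue. \<bar>f x\<bar> powr q) powr (1 / q)"

definition in_Lq :: "real \<Rightarrow> ('a::euclidean_space \<Rightarrow> real) \<Rightarrow> bool" where
  "in_Lq q f \<longleftrightarrow> f \<in> borel_measurable lebesgue \<and> integrable lebesgue (\<lambda>x. \<bar>f x\<bar> powr q)"

(* The class L^\<infinity>_loc((0,\<infinity>), L^q). For finite q, strong measurability of a curve
   in L^q amounts to joint measurability of a representative u. *)
definition Linf_loc_Lq :: "real \<Rightarrow> ('a::euclidean_space \<Rightarrow> real \<Rightarrow> real) \<Rightarrow> bool" where
  "Linf_loc_Lq q u \<longleftrightarrow>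
     (\<lambda>(x, t). u x t) \<in> borel_measurable (lebesgue_on (UNIV \<times> {0<..})) \<and>
     (\<forall>K. compact K \<and> K \<subseteq> {0<..} \<longrightarrow>
        (\<exists>C. AE t in lebesgue. t \<in> K \<longrightarrow>
               in_Lq q (\<lambda>x. u x t) \<and> Lq_norm q (\<lambda>x. u x t) \<le> C))"

definition L1_loc :: "'a::euclidean_space set \<Rightarrow> ('a \<Rightarrow> real) \<Rightarrow> bool" where
  "L1_loc S f \<longleftrightarrow> (\<forall>K. compact K \<and> K \<subseteq> S \<longrightarrow> f absolutely_integrable_on K)"

primrec Ck :: "nat \<Rightarrow> ('a::real_normed_vector \<Rightarrow> real) \<Rightarrow> bool" where
  "Ck 0 f \<longleftrightarrow> continuous_on UNIV f"
| "Ck (Suc k) f \<longleftrightarrow>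
     (\<forall>x. f differentiable (at x)) \<and> (\<forall>v. Ck k (\<lambda>x. frechet_derivative f (at x) v))"

(* The elements of C_0^\<infinity>(R^N \<times> [0,\<infinity>)) are the restrictions to t \<ge> 0 of the smooth
   compactly supported functions on R^N \<times> R. We quantify over the latter; the weak
   formulation only sees their values for t \<ge> 0. *)
definition test_function :: "('a::euclidean_space \<times> real \<Rightarrow> real) \<Rightarrow> bool" where
  "test_function \<psi> \<longleftrightarrow> (\<forall>k. Ck k \<psi>) \<and> compact (closure {z. \<psi> z \<noteq> 0})"

definition laplacian :: "('a::euclidean_space \<Rightarrow> real) \<Rightarrow> 'a \<Rightarrow> real" where
  "laplacian f x = (\<Sum>b\<in>Basis. (deriv ^^ 2) (\<lambda>s. f (x + s *\<^sub>R b)) 0)"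

(* At a time with u(t) = 0 almost everywhere and \<alpha> = 0, the factor 0 powr 0 is 0 rather
   than 1; the product still vanishes almost everywhere in x, as it should. *)
definition nonlinear_term ::
    "real \<Rightarrow> real \<Rightarrow> real \<Rightarrow> ('a::euclidean_space \<Rightarrow> real \<Rightarrow> real) \<Rightarrow> 'a \<times> real \<Rightarrow> real" where
  "nonlinear_term p q \<alpha> u = (\<lambda>(x, t). Lq_norm q (\<lambda>y. u y t) powr \<alpha> * \<bar>u x t\<bar> powr p)"

(* The weak identity presupposes that its integrals converge. Since the local conditions on
   u say nothing near t = 0, where \<psi> need not vanish, and non-integrable functions have
   integral 0 in HOL, convergence of the two integrals involving u is stated explicitly.
   The other two converge whenever u0 and w are in L^1 and \<rho> > -1. *)
definition global_weak_solution ::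
    "real \<Rightarrow> real \<Rightarrow> real \<Rightarrow> real \<Rightarrow> ('a::euclidean_space \<Rightarrow> real) \<Rightarrow> ('a \<Rightarrow> real) \<Rightarrow>
     ('a \<Rightarrow> real \<Rightarrow> real) \<Rightarrow> bool" where
  "global_weak_solution p q \<alpha> \<rho> w u0 u \<longleftrightarrow>
     integrable lebesgue u0 \<and>
     Linf_loc_Lq q u \<and>
     L1_loc (UNIV \<times> {0<..}) (nonlinear_term p q \<alpha> u) \<and>
     (\<forall>\<psi>. test_function \<psi> \<longrightarrow>
        (let Q = UNIV \<times> {0<..};
             L = (\<lambda>(x, t). u x t * (- deriv (\<lambda>s. \<psi> (x, s)) t - laplacian (\<lambda>y. \<psi> (y, t)) x));
             F = (\<lambda>z. nonlinear_term p q \<alpha> u z * \<psi> z)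
         in set_integrable lebesgue Q L \<and> set_integrable lebesgue Q F \<and>
            (LINT z:Q|lebesgue. L z) =
              (LINT x|lebesgue. u0 x * \<psi> (x, 0)) + (LINT z:Q|lebesgue. F z) +
              (LINT (x, t):Q|lebesgue. t powr \<rho> * w x * \<psi> (x, t))))"

end

theory Submission
  imports Defs "HOL-Computational_Algebra.Polynomial" "HOL-Real_Asymp.Real_Asymp"
begin

text \<open>
  Test the equation with \<open>\<psi>(x, t) = \<phi>(x) \<eta>(t)\<close>, where \<open>\<phi>\<close> is a bump on the ball of radius \<open>R\<close> and \<open>\<eta>\<close> a
  bump on \<open>[R\<^sup>2, 3 R\<^sup>2]\<close>, so that the initial datum drops out. Since the bumps are built from \<open>exp (- 1 / x)\<close>,
  \<open>\<bar>\<partial>\<^sub>t\<psi> + \<Delta>\<psi>\<bar> \<le> C R powr (- 2) \<psi> powr (1 / p)\<close>. Put \<open>z = \<integral> \<bar>u(t)\<bar> \<phi> powr (1 / p) dx\<close>. At almost every time, Hoelder's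
  inequality on the ball bounds both \<open>\<parallel>u(t)\<parallel>\<^sub>q\<close> and \<open>\<integral> \<bar>u(t)\<bar> powr p \<phi> dx\<close> from below by powers of \<open>z\<close>, so the nonlinear term
  dominates a multiple of \<open>z powr (p + \<alpha>)\<close>. The nonlocal factor thus only raises the exponent,
  and by Young's inequality it absorbs the linear term up to a constant. Hence the source integral, which grows
  like \<open>R powr (2 \<rho> + 2)\<close> because \<open>w\<close> has positive integral, is bounded by a power of \<open>R\<close> that is
  smaller below the critical exponent.
\<close>

subsection \<open>Smooth cut-off functions\<close>

text \<open>The polynomial in \<open>1 / x\<close> makes the family closed under differentiation, so
  smoothness and derivative bounds of \<open>exp (- 1 / x)\<close> extended by zero can be proved
  for all orders at once.\<close>

definition flat :: "real poly \<Rightarrow> real \<Rightarrow> real" where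
  "flat P x = (if x > 0 then poly P (1 / x) * exp (- 1 / x) else 0)"

abbreviation bump :: "real \<Rightarrow> real" where
  "bump \<equiv> flat 1"

text \<open>With y = 1/x the derivative of P(y) exp(-y) in x is y^2 (P - P')(y) exp(-y); the factor
  y^2 comes from dy/dx = -y^2.\<close>

definition flat_deriv :: "real poly \<Rightarrow> real poly" where
  "flat_deriv P = [:0, 0, 1:] * (P - pderiv P)"

text \<open>Induction along Horner's scheme: half of the decay rate absorbs the new factor y, the
  other half feeds the induction hypothesis. This is why the rate \<open>c\<close> must be arbitrary
  in the induction.\<close>

lemma poly_exp_bounded:
  fixes P :: "real poly"
  assumes "c > 0"
  shows "\<exists>C\<ge>0. \<forall>y\<ge>0. \<bar>poly P y\<bar> * exp (- c * y) \<le> C"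
  using assms
proof (induction P arbitrary: c)
  case 0
  then show ?case by auto
next
  case (pCons a P)
  from pCons.IH[of "c/2"] pCons.prems obtain C where C: "C \<ge> 0"
    "\<And>y. y \<ge> 0 \<Longrightarrow> \<bar>poly P y\<bar> * exp (- (c/2) * y) \<le> C" by auto
  have "\<bar>poly (pCons a P) y\<bar> * exp (- c * y) \<le> \<bar>a\<bar> + 2 / c * C" if y: "y \<ge> 0" for y
  proof -
    have split: "exp (- c * y) = exp (- (c/2) * y) * exp (- (c/2) * y)"
      by (simp flip: exp_add)
    have "c / 2 * y \<le> exp (c / 2 * y)"
      using exp_ge_add_one_self[of "c/2*y"] by linarith
    then have "y * exp (- (c/2) * y) \<le> 2 / c"
      using pCons.prems by (simp add: exp_minus field_simps)
    then have "(y * exp (- (c/2) * y)) * (\<bar>poly P y\<bar> * exp (- (c/2) * y)) \<le> 2 / c * C"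
      using C y pCons.prems by (intro mult_mono) auto
    moreover have "\<bar>a\<bar> * exp (- c * y) \<le> \<bar>a\<bar>"
      using y pCons.prems by (intro mult_right_le_one_le) auto
    moreover have "\<bar>poly (pCons a P) y\<bar> * exp (- c * y) \<le> \<bar>a\<bar> * exp (- c * y) + y * \<bar>poly P y\<bar> * exp (- c * y)"
      using abs_triangle_ineq[of a "y * poly P y"] y
      by (simp add: abs_mult flip: distrib_right)
    ultimately show ?thesis
      unfolding split by (simp only: mult_ac)
  qed
  then show ?case using C(1) pCons.prems by (intro exI[of _ "\<bar>a\<bar> + 2 / c * C"]) auto
qed

text \<open>With y = 1/x, splitting off \<open>bump x powr \<sigma>\<close> = exp(-\<sigma> y)
  leaves |P(y)| exp(-(1-\<sigma>) y), which is bounded. This makes derivatives of the bump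
  controllable by a power of the bump below 1.\<close>

lemma flat_le_bump_powr:
  assumes "\<sigma> < 1"
  shows "\<exists>C\<ge>0. \<forall>x. \<bar>flat P x\<bar> \<le> C * bump x powr \<sigma>"
proof -
  obtain C where C: "C \<ge> 0" "\<And>y. y \<ge> 0 \<Longrightarrow> \<bar>poly P y\<bar> * exp (- (1 - \<sigma>) * y) \<le> C"
    using poly_exp_bounded[of "1 - \<sigma>" P] assms by auto
  have "\<bar>flat P x\<bar> \<le> C * bump x powr \<sigma>" for x
  proof (cases "x > 0")
    case True
    have "\<bar>flat P x\<bar> = (\<bar>poly P (1/x)\<bar> * exp (- (1 - \<sigma>) * (1/x))) * exp (- \<sigma> * (1/x))"
      using True by (simp add: flat_def abs_mult field_simps flip: exp_add)
    also have "\<dots> \<le> C * exp (- \<sigma> * (1/x))"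
      using True by (intro mult_right_mono C) auto
    also have "exp (- \<sigma> * (1/x)) = bump x powr \<sigma>"
      using True by (simp add: flat_def powr_def)
    finally show ?thesis .
  qed (simp add: flat_def)
  then show ?thesis using C(1) by auto
qed

lemma bump_nonneg [simp]: "bump x \<ge> 0"
  by (simp add: flat_def)

lemma bump_pos: "x > 0 \<Longrightarrow> bump x > 0"
  by (simp add: flat_def)

lemma bump_le_1: "bump x \<le> 1"
  by (simp add: flat_def)

lemma flat_nonpos: "x \<le> 0 \<Longrightarrow> flat P x = 0"
  by (simp add: flat_def)

lemma has_real_derivative_flat:
  "(flat P has_real_derivative flat (flat_deriv P) x) (at x)"
proof -
  consider "x > 0" | "x < 0" | "x = 0" by linarith
  then show ?thesis
  proof cases
    case 1
    have "((\<lambda>x. poly P (1 / x) * exp (- 1 / x)) has_real_derivative flat (flat_deriv P) x) (at x)"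
      using 1 by (auto intro!: derivative_eq_intros DERIV_chain'[OF _ poly_DERIV]
          simp: flat_def flat_deriv_def power2_eq_square field_simps)
    then show ?thesis
      by (rule DERIV_cong_ev[THEN iffD1, rotated -1, OF _ refl _ refl])
        (use 1 eventually_nhds_in_open[of "{0<..}" x] in \<open>auto simp: flat_def elim!: eventually_mono\<close>)
  next
    case 2
    have "((\<lambda>x. 0) has_real_derivative flat (flat_deriv P) x) (at x)"
      using 2 by (auto simp: flat_def)
    then show ?thesis
      by (rule DERIV_cong_ev[THEN iffD1, rotated -1, OF _ refl _ refl])
        (use 2 eventually_nhds_in_open[of "{..<0}" x] in \<open>auto simp: flat_def elim!: eventually_mono\<close>)
  next
    case 3
    \<comment> \<open>The two extra powers of 1/h give |\<open>flat P h\<close>| \<le> C h^2, so the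
      difference quotient at 0 is O(|h|) and the derivative there is 0.\<close>
    obtain C where C: "C \<ge> 0" "\<And>y. y \<ge> 0 \<Longrightarrow> \<bar>poly ([:0,0,1:] * P) y\<bar> * exp (- 1 * y) \<le> C"
      using poly_exp_bounded[of 1 "[:0,0,1:] * P"] by auto
    have bound: "\<bar>flat P h / h\<bar> \<le> C * \<bar>h\<bar>" for h
    proof (cases "h > 0")
      case True
      have "\<bar>flat P h / h\<bar> = (\<bar>poly ([:0,0,1:] * P) (1/h)\<bar> * exp (- 1 * (1/h))) * h"
        using True by (simp add: flat_def abs_mult power2_eq_square field_simps)
      also have "\<dots> \<le> C * h"
        using True by (intro mult_right_mono C) auto
      finally show ?thesis using True by simp
    qed (use C(1) in \<open>auto simp: flat_def mult_nonneg_nonpos\<close>)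
    have "(\<lambda>h. flat P h / h) \<midarrow>0\<rightarrow> 0"
    proof (rule Lim_null_comparison)
      show "\<forall>\<^sub>F h in at 0. norm (flat P h / h) \<le> C * \<bar>h\<bar>" using bound by simp
      show "(\<lambda>h. C * \<bar>h\<bar>) \<midarrow>0\<rightarrow> 0" by (auto intro!: tendsto_eq_intros)
    qed
    then show ?thesis
      using 3 by (simp add: DERIV_def flat_def)
  qed
qed

section \<open>Closure properties of the class \<open>Ck\<close>\<close>

text \<open>By uniqueness of the derivative, an explicitly computed one may stand in for
  \<open>frechet_derivative\<close>.\<close>

lemma Ck_SucI:
  assumes "\<And>x. (f has_derivative f' x) (at x)" "\<And>v. Ck k (\<lambda>x. f' x v)"
  shows "Ck (Suc k) f"
proof -
  have "frechet_derivative f (at x) = f' x" for x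
    using frechet_derivative_at[OF assms(1)] by simp
  with assms show ?thesis by (auto simp: differentiable_def)
qed

lemma Ck_SucD:
  assumes "Ck (Suc k) f"
  shows "(f has_derivative frechet_derivative f (at x)) (at x)" "Ck k (\<lambda>x. frechet_derivative f (at x) v)"
  using assms by (auto simp: frechet_derivative_works)

lemma Ck_Suc_imp: "Ck (Suc k) f \<Longrightarrow> Ck k f"
proof (induction k arbitrary: f)
  case 0
  then show ?case
    by (auto intro!: continuous_at_imp_continuous_on differentiable_imp_continuous_within)
next
  case (Suc k)
  from Suc.prems show ?case
    by (subst Ck.simps(2)) (auto simp del: Ck.simps(2) simp: Ck.simps(2)[of "Suc k"] intro!: Suc.IH)
qed

lemma Ck_const: "Ck k (\<lambda>x. c)"
  by (induction k arbitrary: c) (auto simp del: Ck.simps(2) intro!: Ck_SucI has_derivative_const)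

lemma Ck_bounded_linear:
  assumes "bounded_linear f" shows "Ck k f"
proof (cases k)
  case 0
  then show ?thesis using assms by (simp add: linear_continuous_on)
next
  case (Suc m)
  then show ?thesis
    using assms by (auto simp del: Ck.simps(2) intro!: Ck_SucI Ck_const bounded_linear_imp_has_derivative)
qed

lemma Ck_add: "Ck k f \<Longrightarrow> Ck k g \<Longrightarrow> Ck k (\<lambda>x. f x + g x)"
proof (induction k arbitrary: f g)
  case (Suc k)
  show ?case
    by (rule Ck_SucI[OF has_derivative_add[OF Ck_SucD(1) Ck_SucD(1)]])
       (use Suc.prems Ck_SucD(2) Suc.IH in blast)+
qed (simp add: continuous_on_add)

lemma Ck_mult: "Ck k f \<Longrightarrow> Ck k g \<Longrightarrow> Ck k (\<lambda>x. f x * g x)"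
proof (induction k arbitrary: f g)
  case (Suc k)
  show ?case
    by (rule Ck_SucI[OF has_derivative_mult[OF Ck_SucD(1) Ck_SucD(1)]])
       (use Suc.prems in \<open>auto simp del: Ck.simps(2) intro!: Ck_add Suc.IH Ck_SucD(2) intro: Ck_Suc_imp\<close>)
qed (simp add: continuous_on_mult)

text \<open>Differentiating replaces P by \<open>flat_deriv P\<close>, so the induction on the order
  needs P arbitrary.\<close>

lemma Ck_flat: "Ck k f \<Longrightarrow> Ck k (\<lambda>x. flat P (f x))"
proof (induction k arbitrary: P)
  case 0
  have "continuous_on UNIV (flat P)"
    by (intro continuous_at_imp_continuous_on ballI DERIV_isCont[OF has_real_derivative_flat])
  with 0 show ?case
    by (auto intro: continuous_on_compose2)
next
  case (Suc k)
  have "((\<lambda>x. flat P (f x)) has_derivative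
      (\<lambda>v. flat (flat_deriv P) (f x) * frechet_derivative f (at x) v)) (at x)" for x
    using has_derivative_compose[OF Ck_SucD(1)[OF Suc.prems]
        has_real_derivative_flat[THEN has_field_derivative_imp_has_derivative]]
    by (simp add: mult.commute)
  then show ?case
    by (rule Ck_SucI) (use Suc in \<open>auto simp del: Ck.simps(2) intro!: Ck_mult Suc.IH Ck_SucD(2) intro: Ck_Suc_imp\<close>)
qed

section \<open>The parabolically scaled cut-off as a test function\<close>

text \<open>The squared norm keeps the argument of the bump polynomial, hence smooth at the origin;
  for R > 0 it is positive exactly on the open ball of radius R.\<close>

definition space_cutoff :: "real \<Rightarrow> 'a::euclidean_space \<Rightarrow> real" where
  "space_cutoff R x = bump (1 - x \<bullet> x / R\<^sup>2)"

text \<open>For T > 0 the parabola centred at 2T is positive exactly for T < t < 3T, away from the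
  initial time.\<close>

definition time_cutoff :: "real \<Rightarrow> real \<Rightarrow> real" where
  "time_cutoff T t = bump (1 - (t / T - 2)\<^sup>2)"

text \<open>The time scale \<open>R\<^sup>2\<close> is the one for which one time derivative and two
  space derivatives both cost a factor R^(-2).\<close>

definition cutoff :: "real \<Rightarrow> 'a::euclidean_space \<times> real \<Rightarrow> real" where
  "cutoff R = (\<lambda>(x, t). space_cutoff R x * time_cutoff (R\<^sup>2) t)"

lemma space_cutoff_nonneg [simp]: "space_cutoff R x \<ge> 0"
  and time_cutoff_nonneg [simp]: "time_cutoff T t \<ge> 0"
  by (simp_all add: space_cutoff_def time_cutoff_def)

lemma space_cutoff_le_1: "space_cutoff R x \<le> 1"
  and time_cutoff_le_1: "time_cutoff T t \<le> 1"
  by (simp_all add: space_cutoff_def time_cutoff_def bump_le_1)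

lemma space_cutoff_eq_0:
  assumes "R > 0" "x \<notin> ball 0 R" shows "space_cutoff R x = 0"
proof -
  have "R\<^sup>2 \<le> x \<bullet> x"
    using assms by (simp add: dot_square_norm)
  then show ?thesis
    using assms by (simp add: space_cutoff_def flat_nonpos)
qed

lemma time_cutoff_eq_0:
  assumes "T > 0" "t \<notin> {T..3 * T}" shows "time_cutoff T t = 0"
proof -
  have "1 \<le> \<bar>t / T - 2\<bar>"
    using assms by (auto simp: field_simps abs_if)
  then have "1 \<le> (t / T - 2)\<^sup>2"
    using abs_le_square_iff[of 1 "t / T - 2"] by simp
  then show ?thesis by (simp add: time_cutoff_def flat_nonpos)
qed

lemma test_function_cutoff:
  assumes "R > 0"
  shows "test_function (cutoff R :: 'a::euclidean_space \<times> real \<Rightarrow> real)"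
  unfolding test_function_def
proof
  show "\<forall>k. Ck k (cutoff R :: 'a \<times> real \<Rightarrow> real)"
  proof
    fix k
    have sq: "Ck k (\<lambda>z::'a \<times> real. 1 + (- 1 / R\<^sup>2) * (fst z \<bullet> fst z))"
    \<comment> \<open>Raising the order by one makes \<open>Ck_SucI\<close> applicable for every k;
      the derivative of |x|^2 is linear in the base point.\<close>
    proof (intro Ck_add Ck_mult Ck_const, rule Ck_Suc_imp, rule Ck_SucI)
      show "((\<lambda>z. fst z \<bullet> fst z) has_derivative (\<lambda>v. fst z \<bullet> fst v + fst v \<bullet> fst z)) (at z)" for z :: "'a \<times> real"
        by (auto intro!: derivative_eq_intros)
      show "Ck k (\<lambda>z. fst z \<bullet> fst v + fst v \<bullet> fst z)" for v :: "'a \<times> real"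
        by (intro Ck_add Ck_bounded_linear bounded_linear_inner_left_comp bounded_linear_inner_right_comp bounded_linear_fst)
    qed
    have lin: "Ck k (\<lambda>z::'a \<times> real. (1 / R\<^sup>2) * snd z + (-2))"
      by (intro Ck_add Ck_mult Ck_const Ck_bounded_linear bounded_linear_snd)
    have quad: "Ck k (\<lambda>z::'a \<times> real. 1 + (-1) * (((1 / R\<^sup>2) * snd z + (-2)) * ((1 / R\<^sup>2) * snd z + (-2))))"
      by (intro Ck_add[OF Ck_const] Ck_mult[OF Ck_const] Ck_mult lin)
    have "(cutoff R :: 'a \<times> real \<Rightarrow> real) = (\<lambda>z. bump (1 + (- 1 / R\<^sup>2) * (fst z \<bullet> fst z)) *
        bump (1 + (-1) * (((1 / R\<^sup>2) * snd z + (-2)) * ((1 / R\<^sup>2) * snd z + (-2)))))"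
      by (auto simp: cutoff_def space_cutoff_def time_cutoff_def power2_eq_square)
    then show "Ck k (cutoff R :: 'a \<times> real \<Rightarrow> real)"
      by (simp only:) (intro Ck_mult Ck_flat sq quad)
  qed
next
  have "{z. cutoff R z \<noteq> 0} \<subseteq> cball (0::'a) R \<times> {R\<^sup>2..3 * R\<^sup>2}"
  proof clarify
    fix x :: 'a and t assume nz: "cutoff R (x, t) \<noteq> 0"
    then have "x \<in> ball 0 R" "t \<in> {R\<^sup>2..3 * R\<^sup>2}"
      using assms space_cutoff_eq_0[of R x] time_cutoff_eq_0[of "R\<^sup>2" t] by (auto simp: cutoff_def)
    then show "x \<in> cball 0 R \<and> t \<in> {R\<^sup>2..3 * R\<^sup>2}" by auto
  qed
  moreover have "bounded (cball (0::'a) R \<times> {R\<^sup>2..3 * R\<^sup>2})"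
    by (intro bounded_Times) auto
  ultimately show "compact (closure {z::'a \<times> real. cutoff R z \<noteq> 0})"
    by (auto intro: bounded_subset)
qed

section \<open>Derivative bounds for the cut-offs\<close>

text \<open>On a line |x + s b|^2 is a quadratic polynomial in s. Keeping P general lets the rule be
  used a second time, for the second derivative.\<close>

lemma DERIV_flat_space:
  fixes x b :: "'a::euclidean_space"
  shows "((\<lambda>s. flat P (1 - (x + s *\<^sub>R b) \<bullet> (x + s *\<^sub>R b) / R\<^sup>2)) has_real_derivative
     flat (flat_deriv P) (1 - (x + s *\<^sub>R b) \<bullet> (x + s *\<^sub>R b) / R\<^sup>2) * (- 2 * (x \<bullet> b + s * (b \<bullet> b)) / R\<^sup>2)) (at s)"
proof -
  have "((\<lambda>s. x \<bullet> x + 2 * s * (x \<bullet> b) + s\<^sup>2 * (b \<bullet> b)) has_real_derivative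
      2 * (x \<bullet> b + s * (b \<bullet> b))) (at s)"
    by (auto intro!: derivative_eq_intros simp: algebra_simps)
  from DERIV_diff[OF DERIV_const DERIV_cdivide[OF this], of 1 "R\<^sup>2"]
  have "((\<lambda>s. 1 - (x \<bullet> x + 2 * s * (x \<bullet> b) + s\<^sup>2 * (b \<bullet> b)) / R\<^sup>2) has_real_derivative
      - 2 * (x \<bullet> b + s * (b \<bullet> b)) / R\<^sup>2) (at s)"
    by (simp add: minus_divide_left algebra_simps)
  moreover have "(x + s *\<^sub>R b) \<bullet> (x + s *\<^sub>R b) = x \<bullet> x + 2 * s * (x \<bullet> b) + s\<^sup>2 * (b \<bullet> b)" for s
    by (simp add: inner_add_left inner_add_right inner_commute power2_eq_square algebra_simps)
  ultimately have "((\<lambda>s. 1 - (x + s *\<^sub>R b) \<bullet> (x + s *\<^sub>R b) / R\<^sup>2) has_real_derivative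
      - 2 * (x \<bullet> b + s * (b \<bullet> b)) / R\<^sup>2) (at s)" by simp
  from DERIV_chain2[OF has_real_derivative_flat this] show ?thesis .
qed

text \<open>Chain rule for an outer function of h = 1 - |x|^2/R^2, with |grad h|^2 = 4|x|^2/R^4 and
  Laplacian -2 \<open>DIM('a)\<close> / R^2. The constant c will be the time factor.\<close>

lemma laplacian_space_cutoff:
  fixes x :: "'a::euclidean_space"
  shows "laplacian (\<lambda>y. space_cutoff R y * c) x =
    c * (4 * (x \<bullet> x) / R ^ 4 * flat (flat_deriv (flat_deriv 1)) (1 - x \<bullet> x / R\<^sup>2)
       - 2 * DIM('a) / R\<^sup>2 * flat (flat_deriv 1) (1 - x \<bullet> x / R\<^sup>2))"
proof -
  have "(deriv ^^ 2) (\<lambda>s. space_cutoff R (x + s *\<^sub>R b) * c) 0 =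
     c * (4 * (x \<bullet> b)\<^sup>2 / R ^ 4 * flat (flat_deriv (flat_deriv 1)) (1 - x \<bullet> x / R\<^sup>2)
       - 2 / R\<^sup>2 * flat (flat_deriv 1) (1 - x \<bullet> x / R\<^sup>2))" if "b \<in> Basis" for b
  proof -
    have bb: "b \<bullet> b = 1" using that by simp
    have 1: "deriv (\<lambda>s. space_cutoff R (x + s *\<^sub>R b) * c) =
       (\<lambda>s. flat (flat_deriv 1) (1 - (x + s *\<^sub>R b) \<bullet> (x + s *\<^sub>R b) / R\<^sup>2) * (- 2 * (x \<bullet> b + s * (b \<bullet> b)) / R\<^sup>2) * c)"
      unfolding space_cutoff_def
      by (intro ext DERIV_imp_deriv DERIV_cmult_right DERIV_flat_space)
    have "((\<lambda>s. (- 2 * (x \<bullet> b + s * (b \<bullet> b)) / R\<^sup>2)) has_real_derivative - 2 / R\<^sup>2) (at 0)"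
      by (rule DERIV_cdivide) (auto intro!: derivative_eq_intros simp: bb)
    from DERIV_cmult_right[OF DERIV_mult[OF DERIV_flat_space this], of "flat_deriv 1" x b R c]
    show ?thesis
      by (simp add: numeral_2_eq_2 1 DERIV_imp_deriv) (simp add: field_simps eval_nat_numeral)
  qed
  then have "laplacian (\<lambda>y. space_cutoff R y * c) x = (\<Sum>b\<in>Basis.
     c * (4 * (x \<bullet> b)\<^sup>2 / R ^ 4 * flat (flat_deriv (flat_deriv 1)) (1 - x \<bullet> x / R\<^sup>2)
       - 2 / R\<^sup>2 * flat (flat_deriv 1) (1 - x \<bullet> x / R\<^sup>2)))"
    by (simp add: laplacian_def)
  also have "\<dots> = c * (4 * (\<Sum>b\<in>Basis. (x \<bullet> b)\<^sup>2) / R ^ 4 * flat (flat_deriv (flat_deriv 1)) (1 - x \<bullet> x / R\<^sup>2)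
       - 2 * DIM('a) / R\<^sup>2 * flat (flat_deriv 1) (1 - x \<bullet> x / R\<^sup>2))"
    by (simp add: sum_subtractf flip: sum_distrib_left sum_distrib_right sum_divide_distrib)
  also have "(\<Sum>b\<in>Basis. (x \<bullet> b)\<^sup>2) = x \<bullet> x"
    by (simp add: euclidean_inner[of x x] power2_eq_square)
  finally show ?thesis .
qed

lemma laplacian_space_cutoff_bound:
  assumes "\<sigma> < 1"
  shows "\<exists>C\<ge>0. \<forall>R>0. \<forall>c\<ge>0. \<forall>x::'a::euclidean_space.
     \<bar>laplacian (\<lambda>y. space_cutoff R y * c) x\<bar> \<le> C / R\<^sup>2 * (space_cutoff R x powr \<sigma> * c)"
proof -
  obtain C1 where C1: "C1 \<ge> 0" "\<And>x. \<bar>flat (flat_deriv 1) x\<bar> \<le> C1 * bump x powr \<sigma>"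
    using flat_le_bump_powr[OF assms] by metis
  obtain C2 where C2: "C2 \<ge> 0" "\<And>x. \<bar>flat (flat_deriv (flat_deriv 1)) x\<bar> \<le> C2 * bump x powr \<sigma>"
    using flat_le_bump_powr[OF assms] by metis
  have "\<bar>laplacian (\<lambda>y. space_cutoff R y * c) x\<bar> \<le> (4 * C2 + 2 * DIM('a) * C1) / R\<^sup>2 * (space_cutoff R x powr \<sigma> * c)"
    if R: "R > 0" and c: "c \<ge> 0" for R c and x :: 'a
  \<comment> \<open>Outside the ball all flat terms vanish; inside, |x|^2/R^4 \<le> 1/R^2, so both
    terms scale alike.\<close>
  proof (cases "x \<bullet> x < R\<^sup>2")
    case False
    then show ?thesis
      unfolding laplacian_space_cutoff using R by (simp add: flat_nonpos space_cutoff_def)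
  next
    case True
    define r where "r = 1 - x \<bullet> x / R\<^sup>2"
    define a where "a = 4 * (x \<bullet> x) / R ^ 4"
    have a: "0 \<le> a" "a \<le> 4 / R\<^sup>2"
      using True R by (simp_all add: a_def field_simps eval_nat_numeral)
    have "\<bar>a * flat (flat_deriv (flat_deriv 1)) r - 2 * DIM('a) / R\<^sup>2 * flat (flat_deriv 1) r\<bar>
        \<le> a * \<bar>flat (flat_deriv (flat_deriv 1)) r\<bar> + 2 * DIM('a) / R\<^sup>2 * \<bar>flat (flat_deriv 1) r\<bar>"
      using a by (intro order_trans[OF abs_triangle_ineq4]) (simp add: abs_mult)
    also have "\<dots> \<le> 4 / R\<^sup>2 * (C2 * bump r powr \<sigma>) + 2 * DIM('a) / R\<^sup>2 * (C1 * bump r powr \<sigma>)"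
      using a C1 C2 by (intro add_mono mult_mono) auto
    finally have *: "\<bar>a * flat (flat_deriv (flat_deriv 1)) r - 2 * DIM('a) / R\<^sup>2 * flat (flat_deriv 1) r\<bar>
        \<le> 4 / R\<^sup>2 * (C2 * bump r powr \<sigma>) + 2 * DIM('a) / R\<^sup>2 * (C1 * bump r powr \<sigma>)" .
    have "\<bar>laplacian (\<lambda>y. space_cutoff R y * c) x\<bar> =
        c * \<bar>a * flat (flat_deriv (flat_deriv 1)) r - 2 * DIM('a) / R\<^sup>2 * flat (flat_deriv 1) r\<bar>"
      using c by (simp add: laplacian_space_cutoff a_def r_def abs_mult)
    also have "\<dots> \<le> c * (4 / R\<^sup>2 * (C2 * bump r powr \<sigma>) + 2 * DIM('a) / R\<^sup>2 * (C1 * bump r powr \<sigma>))"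
      using * c by (rule mult_left_mono)
    also have "\<dots> = (4 * C2 + 2 * DIM('a) * C1) / R\<^sup>2 * (space_cutoff R x powr \<sigma> * c)"
      by (simp add: space_cutoff_def r_def add_divide_distrib algebra_simps)
    finally show ?thesis .
  qed
  then show ?thesis
    using C1(1) C2(1) by (intro exI[of _ "4 * C2 + 2 * DIM('a) * C1"]) auto
qed

lemma time_cutoff_deriv_bound:
  assumes "\<sigma> < 1"
  shows "\<exists>C\<ge>0. \<forall>T>0. \<forall>t. \<forall>c\<ge>0. \<bar>deriv (\<lambda>s. c * time_cutoff T s) t\<bar> \<le> C / T * (c * time_cutoff T t powr \<sigma>)"
proof -
  obtain C where C: "C \<ge> 0" "\<And>x. \<bar>flat (flat_deriv 1) x\<bar> \<le> C * bump x powr \<sigma>"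
    using flat_le_bump_powr[OF assms] by metis
  have "\<bar>deriv (\<lambda>s. c * time_cutoff T s) t\<bar> \<le> 2 * C / T * (c * time_cutoff T t powr \<sigma>)"
    if T: "T > 0" and c: "c \<ge> 0" for T c t
  proof -
    have "((\<lambda>s. 1 - (s / T - 2)\<^sup>2) has_real_derivative 2 * (2 - t / T) / T) (at t)"
      using T by (auto intro!: derivative_eq_intros simp: divide_simps) (simp add: algebra_simps eval_nat_numeral)
    from DERIV_imp_deriv[OF DERIV_cmult[OF DERIV_chain2[OF has_real_derivative_flat this], of c 1]]
    have eq: "\<bar>deriv (\<lambda>s. c * time_cutoff T s) t\<bar> =
        c * (\<bar>flat (flat_deriv 1) (1 - (t / T - 2)\<^sup>2)\<bar> * (2 * \<bar>t / T - 2\<bar> / T))"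
      unfolding time_cutoff_def using T c by (simp only: abs_mult abs_divide abs_minus_commute[of 2])
    show ?thesis
    \<comment> \<open>The growing factor |t/T - 2| is at most 1 where the bump lives, and beyond
      that the flat factor is zero.\<close>
    proof (cases "\<bar>t / T - 2\<bar> \<le> 1")
      case True
      have "\<bar>flat (flat_deriv 1) (1 - (t / T - 2)\<^sup>2)\<bar> * (2 * \<bar>t / T - 2\<bar> / T)
          \<le> (C * time_cutoff T t powr \<sigma>) * (2 * 1 / T)"
        unfolding time_cutoff_def
        using True T C by (intro mult_mono divide_right_mono) auto
      from mult_left_mono[OF this c] show ?thesis
        unfolding eq by (simp add: mult_ac)
    next
      case False
      then have "1 \<le> (t / T - 2)\<^sup>2"
        using abs_le_square_iff[of 1 "t / T - 2"] by simp
      then show ?thesis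
        unfolding eq by (simp add: flat_nonpos time_cutoff_def)
    qed
  qed
  then show ?thesis
    using C(1) by (intro exI[of _ "2 * C"]) auto
qed

text \<open>A derivative lowers only one of the two factors to the power \<sigma>; the other may be
  lowered too, since y \<le> y^\<sigma> on [0,1].\<close>

lemma heat_cutoff_bound:
  assumes \<sigma>: "0 < \<sigma>" "\<sigma> < 1"
  shows "\<exists>C>0. \<forall>R>0. \<forall>(x::'a::euclidean_space) t.
     \<bar>- deriv (\<lambda>s. cutoff R (x, s)) t - laplacian (\<lambda>y. cutoff R (y, t)) x\<bar>
       \<le> C / R\<^sup>2 * (space_cutoff R x powr \<sigma> * time_cutoff (R\<^sup>2) t powr \<sigma>)"
proof -
  obtain C1 where C1: "C1 \<ge> 0" "\<And>R c x. R > 0 \<Longrightarrow> c \<ge> 0 \<Longrightarrow>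
     \<bar>laplacian (\<lambda>y. space_cutoff R y * c) (x::'a)\<bar> \<le> C1 / R\<^sup>2 * (space_cutoff R x powr \<sigma> * c)"
    using laplacian_space_cutoff_bound[OF \<sigma>(2)] by metis
  obtain C2 where C2: "C2 \<ge> 0" "\<And>T t c. T > 0 \<Longrightarrow> c \<ge> 0 \<Longrightarrow>
     \<bar>deriv (\<lambda>s. c * time_cutoff T s) t\<bar> \<le> C2 / T * (c * time_cutoff T t powr \<sigma>)"
    using time_cutoff_deriv_bound[OF \<sigma>(2)] by metis
  have powr: "y \<le> y powr \<sigma>" if "0 \<le> y" "y \<le> 1" for y :: real
    using that \<sigma> powr_mono'[of \<sigma> 1 y] by simp
  have "\<bar>- deriv (\<lambda>s. cutoff R (x, s)) t - laplacian (\<lambda>y. cutoff R (y, t)) x\<bar>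
       \<le> (C1 + C2 + 1) / R\<^sup>2 * (space_cutoff R x powr \<sigma> * time_cutoff (R\<^sup>2) t powr \<sigma>)"
    if R: "R > 0" for R t and x :: 'a
  proof -
    let ?S = "space_cutoff R x" and ?T = "time_cutoff (R\<^sup>2) t"
    have "\<bar>- deriv (\<lambda>s. cutoff R (x, s)) t - laplacian (\<lambda>y. cutoff R (y, t)) x\<bar>
      \<le> C2 / R\<^sup>2 * (?S * ?T powr \<sigma>) + C1 / R\<^sup>2 * (?S powr \<sigma> * ?T)"
      unfolding cutoff_def prod.case
      using C1(2)[OF R, of ?T x] C2(2)[of "R\<^sup>2" ?S t] R by simp
    \<comment> \<open>The spare summand only serves to make the final constant strictly
      positive.\<close>
    also have "\<dots> \<le> C2 / R\<^sup>2 * (?S powr \<sigma> * ?T powr \<sigma>) + C1 / R\<^sup>2 * (?S powr \<sigma> * ?T powr \<sigma>)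
        + 1 / R\<^sup>2 * (?S powr \<sigma> * ?T powr \<sigma>)"
      using R C1(1) C2(1)
      by (intro add_increasing2 add_mono mult_left_mono mult_right_mono powr space_cutoff_le_1 time_cutoff_le_1) auto
    also have "\<dots> = (C1 + C2 + 1) / R\<^sup>2 * (?S powr \<sigma> * ?T powr \<sigma>)"
      by (simp add: add_divide_distrib algebra_simps)
    finally show ?thesis .
  qed
  then show ?thesis
    using C1(1) C2(1) by (intro exI[of _ "C1 + C2 + 1"]) auto
qed

subsection \<open>The estimate on a time slice\<close>

text \<open>Convexity at the point 1, obtained from Young's inequality with second factor 1.\<close>

lemma powr_ge_tangent:
  fixes x p :: real
  assumes "p \<ge> 1" "x \<ge> 0"
  shows "p * x - (p - 1) \<le> x powr p"
proof (cases "p = 1")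
  case False
  define q where "q = p / (p - 1)"
  have "x * 1 \<le> x powr p / p + 1 powr q / q"
    using assms False by (intro Youngs_inequality) (auto simp: q_def field_simps)
  then have "p * x \<le> p * (x powr p / p + 1 / q)"
    using assms by (intro mult_left_mono) auto
  also have "\<dots> = x powr p + (p - 1)"
    using assms False by (simp add: q_def distrib_left)
  finally show ?thesis by simp
qed (use assms in simp)

text \<open>For A > 0 the threshold (A/B)^(1/(P-1)) is where both terms agree: below it the negative
  term is dropped, above it the power wins. The exact maximiser is avoided.\<close>

lemma linear_minus_powr_le:
  fixes A B P z :: real
  assumes "A \<ge> 0" "B > 0" "P > 1" "z \<ge> 0"
  shows "A * z - B * z powr P \<le> A * (A / B) powr (1 / (P - 1))"
proof (cases "z \<le> (A / B) powr (1 / (P - 1))")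
  case True
  then have "A * z \<le> A * (A / B) powr (1 / (P - 1))"
    using assms by (intro mult_left_mono) auto
  moreover have "0 \<le> B * z powr P" using assms by simp
  ultimately show ?thesis by linarith
next
  case False
  have "A / B = ((A / B) powr (1 / (P - 1))) powr (P - 1)"
    using assms by (simp add: powr_powr)
  also have "\<dots> \<le> z powr (P - 1)"
    using False assms by (intro powr_mono2) auto
  finally have "A \<le> B * z powr (P - 1)" using assms by (simp add: field_simps)
  then have "A * z \<le> B * z powr (P - 1) * z" using assms by (intro mult_right_mono)
  also have "\<dots> = B * z powr P"
    using powr_add[of z "P - 1" 1] assms by simp
  finally have "A * z - B * z powr P \<le> 0" by simp
  also have "0 \<le> A * (A / B) powr (1 / (P - 1))" using assms by simp
  finally show ?thesis .
qed

text \<open>Jensen's inequality on B, obtained by integrating the tangent of x^p at the mean m of g.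
  It serves below for both exponents p and q.\<close>

lemma integral_powr_le:
  fixes g :: "'a \<Rightarrow> real"
  assumes p: "p \<ge> 1" and g: "\<And>x. g x \<ge> 0" "\<And>x. x \<notin> B \<Longrightarrow> g x = 0"
    and int: "integrable M g" "integrable M (\<lambda>x. g x powr p)"
    and B: "B \<in> sets M" "emeasure M B < \<infinity>" "measure M B > 0"
  shows "(\<integral>x. g x \<partial>M) powr p * measure M B powr (1 - p) \<le> (\<integral>x. g x powr p \<partial>M)"
proof -
  define I where "I = (\<integral>x. g x \<partial>M)"
  define m where "m = I / measure M B"
  have I: "I \<ge> 0" unfolding I_def by (intro integral_nonneg_AE) (simp add: g)
  show ?thesis
  proof (cases "I = 0")
    case True
    then show ?thesis by (simp add: I_def[symmetric])
  next
    case False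
    with I B have m: "m > 0" by (simp add: m_def)
    \<comment> \<open>The tangent inequality at 1 is applied to g/m and rescaled; the indicator
      keeps the constant term integrable, and off B both sides are 0.\<close>
    have "m powr p * (p / m * g x - (p - 1) * indicator B x) \<le> g x powr p" for x
    proof (cases "x \<in> B")
      case True
      have "m powr p * (p * (g x / m) - (p - 1)) \<le> m powr p * (g x / m) powr p"
        using p m g by (intro mult_left_mono powr_ge_tangent) auto
      also have "\<dots> = g x powr p"
        using m g by (simp add: powr_divide)
      finally show ?thesis using True by simp
    qed (simp add: g)
    then have "(\<integral>x. m powr p * (p / m * g x - (p - 1) * indicator B x) \<partial>M) \<le> (\<integral>x. g x powr p \<partial>M)"
      using int B by (intro integral_mono) auto
    also have "(\<integral>x. m powr p * (p / m * g x - (p - 1) * indicator B x) \<partial>M) =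
        m powr p * (p / m * I - (p - 1) * measure M B)"
      using int B by (simp add: I_def)
    also have "p / m * I = p * measure M B"
      using False B by (simp add: m_def)
    also have "m powr p * (p * measure M B - (p - 1) * measure M B) = I powr p * measure M B powr (1 - p)"
      using I B by (simp add: m_def powr_divide powr_diff algebra_simps)
    finally show ?thesis by (simp add: I_def)
  qed
qed

section \<open>Slicing and product formulas for the completed measure\<close>

text \<open>Lebesgue measure on a product is a completion, so Fubini is applied to a Borel
  representative g and carried back to f on almost every slice.\<close>

lemma
  fixes f :: "'a::euclidean_space \<times> 'b::euclidean_space \<Rightarrow> real"
  assumes f: "integrable lebesgue f"
  shows AE_integrable_lebesgue_slice: "AE t in lebesgue. integrable lebesgue (\<lambda>x. f (x, t))"
    and integrable_lebesgue_slice_integral: "integrable lebesgue (\<lambda>t. LINT x|lebesgue. f (x, t))"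
    and integral_lebesgue_slices: "(LINT t|lebesgue. LINT x|lebesgue. f (x, t)) = integral\<^sup>L lebesgue f"
proof -
  obtain g where g: "g \<in> borel_measurable lborel" and fg: "AE z in lborel. f z = g z"
    using completion_ex_borel_measurable_real[OF borel_measurable_integrable[OF f]] by auto
  have fg': "AE z in lebesgue. f z = g z"
    using fg by (rule AE_completion)
  have "integrable lebesgue g"
    using f g fg' by (subst integrable_cong_AE[symmetric]) (auto intro: measurable_completion)
  then have "integrable lborel g"
    using g by (simp add: integrable_completion)
  then have int: "integrable (lborel \<Otimes>\<^sub>M lborel) (\<lambda>(x, t). g (x, t))"
    by (simp add: lborel_prod)
  have gm: "(\<lambda>x. g (x, t)) \<in> borel_measurable lborel" for t
    using g by (simp add: lborel_prod[symmetric])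
  have "AE t in lborel. AE x in lborel. f (x, t) = g (x, t)"
  proof -
    \<comment> \<open>Swapping the coordinates puts the time variable outermost, as the slicing of
      null sets requires.\<close>
    have "AE z in distr (lborel \<Otimes>\<^sub>M lborel) (lborel \<Otimes>\<^sub>M lborel) (\<lambda>(t, x). (x, t)). f z = g z"
      by (subst lborel_pair.distr_pair_swap[symmetric], unfold lborel_prod) (rule fg)
    from AE_distrD[OF measurable_pair_swap' this]
    have "AE z in lborel \<Otimes>\<^sub>M lborel. f (snd z, fst z) = g (snd z, fst z)"
      by (simp add: case_prod_beta')
    from lborel_pair.AE_pair[OF this] show ?thesis by simp
  qed
  then have sl: "AE t in lebesgue. AE x in lebesgue. f (x, t) = g (x, t)"
    by (intro AE_completion) (auto elim!: eventually_mono intro: AE_completion)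
  have eq: "AE t in lebesgue. integrable lebesgue (\<lambda>x. f (x, t)) \<and>
      (LINT x|lborel. g (x, t)) = (LINT x|lebesgue. f (x, t))"
    using sl AE_completion[OF lborel_pair.AE_integrable_snd[OF int]]
  proof eventually_elim
    case (elim t)
    have gt: "(\<lambda>x. g (x, t)) \<in> borel_measurable lebesgue"
      using gm by (rule measurable_completion)
    have ft: "(\<lambda>x. f (x, t)) \<in> borel_measurable lebesgue"
      by (rule borel_measurable_AE[OF gt]) (use elim in \<open>auto elim: eventually_mono\<close>)
    have "integrable lebesgue (\<lambda>x. g (x, t))"
      using elim by (simp add: integrable_completion gm)
    moreover have "integrable lebesgue (\<lambda>x. f (x, t)) \<longleftrightarrow> integrable lebesgue (\<lambda>x. g (x, t))"
      using elim by (intro integrable_cong_AE ft gt) auto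
    moreover have "(LINT x|lebesgue. f (x, t)) = (LINT x|lebesgue. g (x, t))"
      using elim by (intro integral_cong_AE ft gt) auto
    ultimately show ?case using integral_completion[OF gm] by simp
  qed
  then show "AE t in lebesgue. integrable lebesgue (\<lambda>x. f (x, t))"
    by (auto elim: eventually_mono)
  have G: "integrable lborel (\<lambda>t. LINT x|lborel. g (x, t))"
    by (rule lborel_pair.integrable_snd[OF int])
  then have G': "integrable lebesgue (\<lambda>t. LINT x|lborel. g (x, t))"
    by (simp add: integrable_completion)
  have F: "(\<lambda>t. LINT x|lebesgue. f (x, t)) \<in> borel_measurable lebesgue"
    by (rule borel_measurable_AE[OF borel_measurable_integrable[OF G']]) (use eq in \<open>auto elim: eventually_mono\<close>)
  show "integrable lebesgue (\<lambda>t. LINT x|lebesgue. f (x, t))"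
    by (rule integrable_cong_AE_imp[OF G' F]) (use eq in \<open>auto elim: eventually_mono\<close>)
  have "(LINT t|lebesgue. LINT x|lebesgue. f (x, t)) = (LINT t|lebesgue. LINT x|lborel. g (x, t))"
    by (rule integral_cong_AE[OF F borel_measurable_integrable[OF G']]) (use eq in \<open>auto elim: eventually_mono\<close>)
  also have "\<dots> = (LINT t|lborel. LINT x|lborel. g (x, t))"
    using G by (intro integral_completion) auto
  also have "\<dots> = integral\<^sup>L lborel g"
    using lborel_pair.integral_snd[OF int] by (simp add: lborel_prod)
  also have "\<dots> = integral\<^sup>L lebesgue g"
    using g by (simp add: integral_completion)
  also have "\<dots> = integral\<^sup>L lebesgue f"
    using f g fg' by (intro integral_cong_AE) (auto intro: measurable_completion)
  finally show "(LINT t|lebesgue. LINT x|lebesgue. f (x, t)) = integral\<^sup>L lebesgue f" .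
qed

lemma integral_lebesgue_tensor:
  fixes f :: "'a::euclidean_space \<Rightarrow> real" and g :: "'b::euclidean_space \<Rightarrow> real"
  assumes f: "integrable lborel f" and g: "integrable lborel g"
  shows "(LINT z|lebesgue. f (fst z) * g (snd z)) = (LINT x|lborel. f x) * (LINT t|lborel. g t)"
proof -
  have m: "(\<lambda>z. f (fst z) * g (snd z)) \<in> borel_measurable (lborel \<Otimes>\<^sub>M lborel)"
    using f g by measurable
  have "integrable (lborel \<Otimes>\<^sub>M lborel) (\<lambda>z. f (fst z) * g (snd z))"
    by (rule lborel_pair.Fubini_integrable[OF m]) (use f g in \<open>simp_all add: abs_mult\<close>)
  from lborel_pair.integral_fst'[OF this]
  have "(LINT x|lborel. f x) * (LINT t|lborel. g t) = integral\<^sup>L (lborel \<Otimes>\<^sub>M lborel) (\<lambda>z. f (fst z) * g (snd z))"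
    by simp
  also have "\<dots> = (LINT z|lebesgue. f (fst z) * g (snd z))"
    using m by (simp add: lborel_prod integral_completion)
  finally show ?thesis by simp
qed

text \<open>Both factors of the nonlinear term are bounded below by powers of one quantity, the
  integral of g; their exponents add up to p + \<alpha> > 1, which absorbs the linear term.\<close>

lemma integral_slice_le:
  fixes f \<phi> l :: "'a::euclidean_space \<Rightarrow> real" and p q \<alpha> \<eta> A :: real
  defines "F \<equiv> (\<lambda>x. Lq_norm q f powr \<alpha> * \<bar>f x\<bar> powr p * (\<phi> x * \<eta>))"
  assumes pq: "p > 1" "q \<ge> 1" "\<alpha> \<ge> 0"
    and B: "B \<in> sets lebesgue" "emeasure lebesgue B < \<infinity>" "measure lebesgue B > 0"
    and \<phi>: "\<phi> \<in> borel_measurable lebesgue" "\<And>x. 0 \<le> \<phi> x" "\<And>x. \<phi> x \<le> 1" "\<And>x. x \<notin> B \<Longrightarrow> \<phi> x = 0"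
    and \<eta>: "0 \<le> \<eta>" "\<eta> \<le> 1"
    and f: "in_Lq q f"
    and A: "A \<ge> 0" "\<And>x. \<bar>l x\<bar> \<le> A * (\<bar>f x\<bar> * (\<phi> x powr (1 / p) * \<eta> powr (1 / p)))"
    and l: "integrable lebesgue l" and F: "integrable lebesgue F"
  shows "(LINT x|lebesgue. \<bar>l x\<bar> - F x) \<le>
    A * (A / measure lebesgue B powr (1 - p - \<alpha> * (1 - 1 / q))) powr (1 / (p + \<alpha> - 1))"
proof -
  define M where "M = measure lebesgue B"
  have M: "M > 0" using B by (simp add: M_def)
  \<comment> \<open>Chosen so that g^p = |f|^p \<phi>, while |l| is at most
    \<open>A * \<eta> powr (1 / p)\<close> times g.\<close>
  define g where "g = (\<lambda>x. \<bar>f x\<bar> * \<phi> x powr (1 / p))"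
  have fm[measurable]: "f \<in> borel_measurable lebesgue" and fq: "integrable lebesgue (\<lambda>x. \<bar>f x\<bar> powr q)"
    using f by (auto simp: in_Lq_def)
  note [measurable] = \<phi>(1) B(1)
  have gm[measurable]: "g \<in> borel_measurable lebesgue"
    unfolding g_def by measurable
  have \<phi>1: "\<phi> x powr (1 / p) \<le> 1" for x
    using powr_mono2[of "1/p" "\<phi> x" 1] \<phi>(2,3)[of x] pq by simp
  have g0: "g x \<ge> 0" for x by (simp add: g_def)
  have gf: "g x \<le> \<bar>f x\<bar>" for x
    using mult_left_mono[OF \<phi>1, of "\<bar>f x\<bar>" x] by (simp add: g_def)
  have gB: "g x = 0" if "x \<notin> B" for x using \<phi>(4)[OF that] by (simp add: g_def)
  have gp: "g x powr p = \<bar>f x\<bar> powr p * \<phi> x" for x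
    using pq \<phi>(2)[of x] by (simp add: g_def powr_mult powr_powr)
  \<comment> \<open>On B, of finite measure, |f| \<le> 1 + |f|^q because q \<ge> 1; off B the
    function g is zero.\<close>
  have gi: "integrable lebesgue g"
  proof (rule Bochner_Integration.integrable_bound)
    show "integrable lebesgue (\<lambda>x. indicator B x + \<bar>f x\<bar> powr q)"
      using fq B by (intro Bochner_Integration.integrable_add) auto
    have "\<bar>f x\<bar> \<le> 1 + \<bar>f x\<bar> powr q" for x
    proof (cases "\<bar>f x\<bar> \<le> 1")
      case False
      then show ?thesis using powr_mono[of 1 q "\<bar>f x\<bar>"] pq by simp
    qed (simp add: add_increasing2)
    then have "norm (g x) \<le> norm (indicator B x + \<bar>f x\<bar> powr q)" for x
      using gf[of x] g0[of x] gB[of x] by (cases "x \<in> B") (auto intro: order_trans)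
    then show "AE x in lebesgue. norm (g x) \<le> norm (indicator B x + \<bar>f x\<bar> powr q)" by simp
  qed simp
  have gqi: "integrable lebesgue (\<lambda>x. g x powr q)"
  proof (rule Bochner_Integration.integrable_bound[OF fq])
    show "AE x in lebesgue. norm (g x powr q) \<le> norm (\<bar>f x\<bar> powr q)"
      using gf g0 pq by (auto intro!: powr_mono2)
  qed simp
  define a where "a = (LINT x|lebesgue. g x)"
  have a: "a \<ge> 0" unfolding a_def by (intro integral_nonneg_AE) (simp add: g0)
  define n where "n = Lq_norm q f"
  have n: "n \<ge> 0" by (simp add: n_def Lq_norm_def)
  define K where "K = A * (A / M powr (1 - p - \<alpha> * (1 - 1 / q))) powr (1 / (p + \<alpha> - 1))"
  have K: "K \<ge> 0" using A by (simp add: K_def)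
  have F0: "F x \<ge> 0" for x using \<phi>(2) \<eta> by (simp add: F_def)
  \<comment> \<open>If \<eta> or the norm vanishes, F carries no information, but then l is zero
    (almost everywhere). Otherwise dividing F by \<open>n powr \<alpha> * \<eta>\<close> yields
    integrability of g^p.\<close>
  consider "\<eta> = 0" | "n = 0" | "\<eta> > 0" "n > 0" using \<eta> n by linarith
  then have "(LINT x|lebesgue. \<bar>l x\<bar> - F x) \<le> K"
  proof cases
    case 1
    then have "l x = 0" "F x = 0" for x using A(2)[of x] by (auto simp: F_def)
    then show ?thesis using K by simp
  next
    case 2
    then have "(LINT x|lebesgue. \<bar>f x\<bar> powr q) = 0"
      by (simp add: n_def Lq_norm_def)
    then have "AE x in lebesgue. \<bar>f x\<bar> powr q = 0"
      by (subst (asm) integral_nonneg_eq_0_iff_AE[OF fq]) auto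
    then have "AE x in lebesgue. \<bar>l x\<bar> - F x \<le> 0"
    proof eventually_elim
      case (elim x)
      then show ?case using A(2)[of x] F0[of x] by simp
    qed
    then have "(LINT x|lebesgue. \<bar>l x\<bar> - F x) \<le> (LINT x|(lebesgue :: 'a measure). 0)"
      using l F by (intro integral_mono_AE) auto
    then show ?thesis using K by simp
  next
    case 3
    have gpi: "integrable lebesgue (\<lambda>x. g x powr p)"
    proof -
      have "integrable lebesgue (\<lambda>x. F x / (n powr \<alpha> * \<eta>))" using F by simp
      also have "(\<lambda>x. F x / (n powr \<alpha> * \<eta>)) = (\<lambda>x. g x powr p)"
        using 3 by (simp add: F_def gp n_def fun_eq_iff)
      finally show ?thesis .
    qed
    have "a powr q * M powr (1 - q) \<le> (LINT x|lebesgue. g x powr q)"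
      unfolding a_def M_def by (intro integral_powr_le pq g0 gB gi gqi B)
    also have "\<dots> \<le> (LINT x|lebesgue. \<bar>f x\<bar> powr q)"
      using gqi fq gf g0 pq by (intro integral_mono) (auto intro!: powr_mono2)
    finally have "(a powr q * M powr (1 - q)) powr (1 / q) \<le> n"
      using pq a M unfolding n_def Lq_norm_def by (intro powr_mono2) auto
    then have "((a powr q * M powr (1 - q)) powr (1 / q)) powr \<alpha> \<le> n powr \<alpha>"
      using pq by (intro powr_mono2) auto
    also have "((a powr q * M powr (1 - q)) powr (1 / q)) powr \<alpha> = a powr \<alpha> * M powr (- \<alpha> * (1 - 1 / q))"
    proof -
      have "(1 - q) * (1 / q) * \<alpha> = - \<alpha> * (1 - 1 / q)"
        using pq by (simp add: field_simps)
      then show ?thesis using pq a M by (simp add: powr_mult powr_powr)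
    qed
    finally have na: "a powr \<alpha> * M powr (- \<alpha> * (1 - 1 / q)) \<le> n powr \<alpha>" .
    have "a powr p * M powr (1 - p) \<le> (LINT x|lebesgue. g x powr p)"
      unfolding a_def M_def by (intro integral_powr_le g0 gB gi gpi B) (use pq in auto)
    then have "a powr \<alpha> * M powr (- \<alpha> * (1 - 1 / q)) * (a powr p * M powr (1 - p)) * \<eta>
        \<le> n powr \<alpha> * (LINT x|lebesgue. g x powr p) * \<eta>"
      using na \<eta> by (intro mult_mono) auto
    also have "\<dots> = (LINT x|lebesgue. F x)"
      by (simp add: F_def gp n_def mult_ac flip: integral_mult_right_zero)
    also have "a powr \<alpha> * M powr (- \<alpha> * (1 - 1 / q)) * (a powr p * M powr (1 - p)) * \<eta> =
        M powr (1 - p - \<alpha> * (1 - 1 / q)) * (\<eta> powr (1 / (p + \<alpha>)) * a) powr (p + \<alpha>)"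
    proof -
      have "(\<eta> powr (1 / (p + \<alpha>)) * a) powr (p + \<alpha>) = \<eta> * (a powr p * a powr \<alpha>)"
        unfolding powr_add[of a, symmetric] using \<eta> a pq by (simp add: powr_mult powr_powr)
      moreover have "M powr (1 - p - \<alpha> * (1 - 1 / q)) = M powr (1 - p) * M powr (- \<alpha> * (1 - 1 / q))"
        by (simp flip: powr_add)
      ultimately show ?thesis by (simp only: mult_ac)
    qed
    finally have F_ge: "M powr (1 - p - \<alpha> * (1 - 1 / q)) * (\<eta> powr (1 / (p + \<alpha>)) * a) powr (p + \<alpha>) \<le> (LINT x|lebesgue. F x)" .
    have "(LINT x|lebesgue. \<bar>l x\<bar>) \<le> (LINT x|lebesgue. A * \<eta> powr (1 / p) * g x)"
    proof (rule integral_mono)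
      show "integrable lebesgue (\<lambda>x. A * \<eta> powr (1 / p) * g x)" using gi by simp
    qed (use l A(2) in \<open>simp_all add: g_def mult_ac\<close>)
    also have "\<dots> = A * (\<eta> powr (1 / p) * a)"
      by (simp add: a_def)
    \<comment> \<open>Since \<eta> \<le> 1 and \<alpha> \<ge> 0, lowering the exponent enlarges the
      power of \<eta>; both terms now depend on the same variable z = \<eta>^(1/(p+\<alpha>))
      a.\<close>
    also have "\<dots> \<le> A * (\<eta> powr (1 / (p + \<alpha>)) * a)"
      using \<eta> a A pq by (intro mult_left_mono mult_right_mono powr_mono') (auto simp: field_simps)
    finally have "(LINT x|lebesgue. \<bar>l x\<bar> - F x) \<le> A * (\<eta> powr (1 / (p + \<alpha>)) * a) -
        M powr (1 - p - \<alpha> * (1 - 1 / q)) * (\<eta> powr (1 / (p + \<alpha>)) * a) powr (p + \<alpha>)"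
      using F_ge l F by simp
    also have "\<dots> \<le> K"
      unfolding K_def using A M pq a by (intro linear_minus_powr_le) auto
    finally show ?thesis .
  qed
  then show ?thesis by (simp add: K_def M_def)
qed

subsection \<open>Integration in time and scaling\<close>

lemma continuous_on_space_cutoff: "continuous_on UNIV (space_cutoff R :: 'a::euclidean_space \<Rightarrow> real)"
  and continuous_on_time_cutoff: "continuous_on UNIV (time_cutoff T)"
proof -
  have b: "continuous_on UNIV bump"
    by (intro continuous_at_imp_continuous_on ballI DERIV_isCont[OF has_real_derivative_flat])
  have "continuous_on UNIV (\<lambda>x::'a. 1 - x \<bullet> x / R\<^sup>2)" "continuous_on UNIV (\<lambda>t. 1 - (t / T - 2)\<^sup>2)"
    by (cases "R = 0"; cases "T = 0"; auto intro!: continuous_intros)+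
  then show "continuous_on UNIV (space_cutoff R :: 'a \<Rightarrow> real)" "continuous_on UNIV (time_cutoff T)"
    unfolding space_cutoff_def[abs_def] time_cutoff_def[abs_def]
    by (auto intro: continuous_on_compose2[OF b])
qed

text \<open>Dominated convergence with majorant |w|; the cut-off tends pointwise to
  \<open>bump 1\<close> = exp(-1) rather than to 1.\<close>

lemma tendsto_integral_space_cutoff:
  fixes w :: "'a::euclidean_space \<Rightarrow> real"
  assumes w: "integrable lborel w"
  shows "((\<lambda>R. LINT x|lborel. w x * space_cutoff R x) \<longlongrightarrow> bump 1 * (LINT x|lborel. w x)) at_top"
proof -
  have [measurable]: "(space_cutoff R :: 'a \<Rightarrow> real) \<in> borel_measurable borel" for R
    by (rule borel_measurable_continuous_onI[OF continuous_on_space_cutoff])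
  note [measurable] = borel_measurable_integrable[OF w]
  have "((\<lambda>R. LINT x|lborel. w x * space_cutoff R x) \<longlongrightarrow> (LINT x|lborel. w x * bump 1)) at_top"
  proof (rule integral_dominated_convergence_at_top[where w = "\<lambda>x. norm (w x)"])
    show "\<forall>\<^sub>F R in at_top. AE x in lborel. norm (w x * space_cutoff R x) \<le> norm (w x)"
      by (auto simp: abs_mult intro!: always_eventually mult_left_le space_cutoff_le_1)
    have "((\<lambda>R. w x * space_cutoff R x) \<longlongrightarrow> w x * bump 1) at_top" for x
    proof -
      have "((\<lambda>R. 1 - x \<bullet> x / R\<^sup>2) \<longlongrightarrow> 1 - 0) at_top"
        by (intro tendsto_diff tendsto_const tendsto_divide_0[OF tendsto_const]
            filterlim_at_top_imp_at_infinity filterlim_pow_at_top filterlim_ident) auto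
      then show ?thesis
        unfolding space_cutoff_def
        by (intro tendsto_mult tendsto_const isCont_tendsto_compose[OF DERIV_isCont[OF has_real_derivative_flat]]) simp
    qed
    then show "AE x in lborel. ((\<lambda>R. w x * space_cutoff R x) \<longlongrightarrow> w x * bump 1) at_top" by simp
  qed (use w in simp_all)
  then show ?thesis by (simp add: mult.commute)
qed

lemma integral_time_cutoff_ge:
  assumes T: "T > 0" and \<rho>: "\<rho> \<le> 0"
  shows "integrable lborel (\<lambda>t. indicator {0<..} t * (t powr \<rho> * time_cutoff T t))"
    and "T * ((3 * T) powr \<rho> * bump (3 / 4)) \<le> (LINT t|lborel. indicator {0<..} t * (t powr \<rho> * time_cutoff T t))"
proof -
  let ?g = "\<lambda>t. indicator {0<..} t * (t powr \<rho> * time_cutoff T t) :: real"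
  have [measurable]: "time_cutoff T \<in> borel_measurable borel"
    by (rule borel_measurable_continuous_onI[OF continuous_on_time_cutoff])
  have g0: "?g t = 0" if "t \<notin> {T..3*T}" for t
    using time_cutoff_eq_0[OF T that] by simp
  show int: "integrable lborel ?g"
  proof (rule Bochner_Integration.integrable_bound)
    show "integrable lborel (\<lambda>t. indicator {T..3*T} t * T powr \<rho>)"
      by (intro integrable_mult_left integrable_real_indicator) (auto simp: emeasure_lborel_Icc_eq)
    have "norm (?g t) \<le> norm (indicator {T..3*T} t * T powr \<rho>)" for t
    proof (cases "t \<in> {T..3*T}")
      case True
      then have "t powr \<rho> \<le> T powr \<rho>"
        using T \<rho> by (intro powr_mono2') auto
      then have "t powr \<rho> * time_cutoff T t \<le> T powr \<rho> * 1"
        by (intro mult_mono time_cutoff_le_1) auto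
      then show ?thesis using True T by simp
    qed (simp add: g0)
    then show "AE t in lborel. norm (?g t) \<le> norm (indicator {T..3*T} t * T powr \<rho>)" by simp
  qed measurable
  \<comment> \<open>On this middle half of [T, 3T], of length T, |t/T - 2| \<le> 1/2 makes the
    bump's argument at least 3/4, and t \<le> 3T with \<rho> \<le> 0 bounds t^\<rho> from
    below.\<close>
  have "(LINT t|lborel. indicator {3/2*T..5/2*T} t * ((3 * T) powr \<rho> * bump (3 / 4))) \<le> (LINT t|lborel. ?g t)"
  proof (rule integral_mono[OF _ int])
    show "integrable lborel (\<lambda>t. indicator {3/2*T..5/2*T} t * ((3 * T) powr \<rho> * bump (3 / 4)))"
      by (intro integrable_mult_left integrable_real_indicator) (auto simp: emeasure_lborel_Icc_eq)
    show "indicator {3/2*T..5/2*T} t * ((3 * T) powr \<rho> * bump (3 / 4)) \<le> ?g t" for t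
    proof (cases "t \<in> {3/2*T..5/2*T}")
      case True
      then have "t / T - 2 \<le> 1 / 2" "- (1 / 2) \<le> t / T - 2"
        using T by (auto simp: field_simps)
      then have "\<bar>t / T - 2\<bar> \<le> 1 / 2" by linarith
      then have "(t / T - 2)\<^sup>2 \<le> 1 / 4"
        using abs_le_square_iff[of "t / T - 2" "1/2"] by (simp add: power2_eq_square)
      then have "bump (3 / 4) \<le> time_cutoff T t"
        by (simp add: time_cutoff_def flat_def field_simps)
      moreover have "(3 * T) powr \<rho> \<le> t powr \<rho>"
        using T \<rho> True by (intro powr_mono2') auto
      ultimately show ?thesis
        using True T by (auto intro!: mult_mono)
    qed simp
  qed
  then show "T * ((3 * T) powr \<rho> * bump (3 / 4)) \<le> (LINT t|lborel. ?g t)"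
    using T by simp
qed

text \<open>The left side is a multiple of R^(2\<rho>+2), the right side one of R^((Ns-2)r). The gap
  \<open>e\<close> between the exponents is positive, so R^e would stay bounded as R tends to
  infinity.\<close>

lemma scaling_contradiction:
  fixes N :: nat and s r \<rho> a c V :: real
  assumes pos: "a > 0" "c > 0" "V > 0" "r > 0"
    and exponent: "(N * s - 2) * r < 2 * \<rho> + 2"
    and le: "\<forall>\<^sub>F R in at_top. a * (R\<^sup>2 * (3 * R\<^sup>2) powr \<rho>) \<le> 2 * R\<^sup>2 * (c / R\<^sup>2 * (c / R\<^sup>2 / (V * R ^ N) powr (- s)) powr r)"
  shows False
proof -
  define e where "e = 2 * \<rho> + 2 - (N * s - 2) * r"
  define b where "b = a * 3 powr \<rho>"
  define d where "d = 2 * c * (c * V powr s) powr r"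
  have "b > 0" using pos by (simp add: b_def)
  have "e > 0" unfolding e_def using exponent by linarith
  have "\<forall>\<^sub>F R in at_top. b * R powr e \<le> d"
    using le eventually_gt_at_top[of "0::real"]
  proof eventually_elim
    case (elim R)
    note R = \<open>R > 0\<close>
    have "(3 * R\<^sup>2) powr \<rho> = 3 powr \<rho> * R powr (2 * \<rho>)"
      using R powr_powr[of R 2 \<rho>] by (simp add: powr_mult)
    then have "a * (R\<^sup>2 * (3 * R\<^sup>2) powr \<rho>) = b * R powr (2 * \<rho> + 2)"
      using R by (simp add: b_def powr_add)
    moreover have "2 * R\<^sup>2 * (c / R\<^sup>2 * (c / R\<^sup>2 / (V * R ^ N) powr (- s)) powr r) = d * R powr ((N * s - 2) * r)"
    proof -
      have "(V * R ^ N) powr s = V powr s * R powr (N * s)"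
        using R pos powr_powr[of R N s] by (simp add: powr_mult powr_realpow)
      then have "c / R\<^sup>2 / (V * R ^ N) powr (- s) = c * V powr s * R powr (N * s - 2)"
        using R by (simp add: powr_minus powr_diff divide_inverse mult_ac)
      then have "(c / R\<^sup>2 / (V * R ^ N) powr (- s)) powr r = (c * V powr s) powr r * R powr ((N * s - 2) * r)"
        using R pos by (simp add: powr_mult powr_powr)
      then show ?thesis using R by (simp add: d_def)
    qed
    ultimately have "b * R powr (2 * \<rho> + 2) \<le> d * R powr ((N * s - 2) * r)"
      using elim by simp
    moreover have "R powr (2 * \<rho> + 2) = R powr e * R powr ((N * s - 2) * r)"
      by (simp add: e_def flip: powr_add)
    ultimately have "b * R powr e * R powr ((N * s - 2) * r) \<le> d * R powr ((N * s - 2) * r)"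
      by simp
    then show ?case using R by simp
  qed
  moreover have "filterlim (\<lambda>R. b * R powr e) at_top at_top"
    using \<open>b > 0\<close> \<open>e > 0\<close>
    by real_asymp
  then have "\<forall>\<^sub>F R in at_top. d < b * R powr e"
    by (simp add: filterlim_at_top_dense)
  ultimately have "\<forall>\<^sub>F R :: real in at_top. False"
    by eventually_elim simp
  then show False by simp
qed

text \<open>The left side is the source term of the weak identity tested with
  \<open>cutoff R\<close>. The slice estimate bounds it by a constant per time, and only the time
  interval of length 2R^2 contributes.\<close>

lemma global_weak_solution_source_bound:
  fixes u :: "'a::euclidean_space \<Rightarrow> real \<Rightarrow> real" and w :: "'a \<Rightarrow> real"
  assumes pq: "p > 1" "q \<ge> 1" "\<alpha> \<ge> 0" and \<rho>: "\<rho> \<le> 0"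
    and w: "integrable lborel w"
    and u: "global_weak_solution p q \<alpha> \<rho> w u0 u"
    and C: "C \<ge> 0"
    and heat: "\<And>(x::'a) t. \<bar>- deriv (\<lambda>s. cutoff R (x, s)) t - laplacian (\<lambda>y. cutoff R (y, t)) x\<bar>
       \<le> C / R\<^sup>2 * (space_cutoff R x powr (1 / p) * time_cutoff (R\<^sup>2) t powr (1 / p))"
    and R: "R > 0"
  shows "(LINT x|lborel. w x * space_cutoff R x) * (LINT t|lborel. indicator {0<..} t * (t powr \<rho> * time_cutoff (R\<^sup>2) t))
    \<le> 2 * R\<^sup>2 * (C / R\<^sup>2 * (C / R\<^sup>2 / measure lebesgue (ball (0::'a) R) powr (1 - p - \<alpha> * (1 - 1 / q))) powr (1 / (p + \<alpha> - 1)))"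
proof -
  define Q where "Q = (UNIV :: 'a set) \<times> {0::real<..}"
  define H where "H = (\<lambda>(x::'a, t). - deriv (\<lambda>s. cutoff R (x, s)) t - laplacian (\<lambda>y. cutoff R (y, t)) x)"
  \<comment> \<open>Extension by zero turns set integrals over Q into integrals over the whole
    space, where slicing applies.\<close>
  define L where "L = (\<lambda>z. indicator Q z * (u (fst z) (snd z) * H z))"
  define F where "F = (\<lambda>z. indicator Q z * (nonlinear_term p q \<alpha> u z * cutoff R z))"
  define T where "T = R\<^sup>2"
  have T: "T > 0" using R by (simp add: T_def)
  define K where "K = C / R\<^sup>2 * (C / R\<^sup>2 / measure lebesgue (ball (0::'a) R) powr (1 - p - \<alpha> * (1 - 1 / q))) powr (1 / (p + \<alpha> - 1))"
  define W where "W = (LINT z:Q|lebesgue. (case z of (x, t) \<Rightarrow> t powr \<rho> * w x * cutoff R (x, t)))"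
  have \<psi>0: "cutoff R (x, 0) = 0" for x :: 'a
    using time_cutoff_eq_0[OF T, of 0] T by (simp add: cutoff_def T_def)
  from u[unfolded global_weak_solution_def] test_function_cutoff[OF R, where ?'a = 'a]
  have "set_integrable lebesgue Q (\<lambda>(x, t). u x t * (- deriv (\<lambda>s. cutoff R (x, s)) t - laplacian (\<lambda>y. cutoff R (y, t)) x))"
    "set_integrable lebesgue Q (\<lambda>z. nonlinear_term p q \<alpha> u z * cutoff R z)"
    "(LINT z:Q|lebesgue. (\<lambda>(x, t). u x t * (- deriv (\<lambda>s. cutoff R (x, s)) t - laplacian (\<lambda>y. cutoff R (y, t)) x)) z) =
       (LINT x|lebesgue. u0 x * cutoff R (x, 0)) + (LINT z:Q|lebesgue. nonlinear_term p q \<alpha> u z * cutoff R z) + W"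
    unfolding Q_def W_def Let_def by blast+
  moreover have "(\<lambda>z. indicator Q z *\<^sub>R (\<lambda>(x, t). u x t * (- deriv (\<lambda>s. cutoff R (x, s)) t - laplacian (\<lambda>y. cutoff R (y, t)) x)) z) = L"
    "(\<lambda>z. indicator Q z *\<^sub>R (nonlinear_term p q \<alpha> u z * cutoff R z)) = F"
    by (auto simp: L_def F_def H_def fun_eq_iff)
  ultimately have L: "integrable lebesgue L" and F: "integrable lebesgue F"
    and eq: "(LINT z|lebesgue. L z) = (LINT z|lebesgue. F z) + W"
    unfolding set_integrable_def set_lebesgue_integral_def by (simp_all add: \<psi>0)
  have D: "integrable lebesgue (\<lambda>z. \<bar>L z\<bar> - F z)" using L F by simp
  \<comment> \<open>The weak identity gives W as the integral of L minus that of F; passing to |L|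
    prepares the slicewise absorption.\<close>
  have "W \<le> (LINT z|lebesgue. \<bar>L z\<bar> - F z)"
    using eq integral_abs_bound[of lebesgue L] L F by simp
  also have "\<dots> = (LINT t|lebesgue. LINT x|lebesgue. \<bar>L (x, t)\<bar> - F (x, t))"
    by (rule integral_lebesgue_slices[OF D, symmetric])
  also have "\<dots> \<le> (LINT t|lebesgue. indicator {T..3*T} t * K)"
  proof (rule integral_mono_AE)
    show "integrable lebesgue (\<lambda>t. LINT x|lebesgue. \<bar>L (x, t)\<bar> - F (x, t))"
      by (rule integrable_lebesgue_slice_integral[OF D])
    show "integrable lebesgue (\<lambda>t. indicator {T..3*T} t * K)"
      by (intro integrable_mult_left integrable_real_indicator) (auto simp: emeasure_lborel_Icc_eq)
    \<comment> \<open>The support in time is compact in (0, \<infinity>), so the local condition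
      puts almost every relevant slice in L^q.\<close>
    have "compact {T..3*T} \<and> {T..3*T} \<subseteq> {0<..}" using T by auto
    then have "AE t in lebesgue. t \<in> {T..3*T} \<longrightarrow> in_Lq q (\<lambda>x. u x t)"
      using u unfolding global_weak_solution_def Linf_loc_Lq_def by (blast intro: AE_mp[OF _ AE_I2])
    then show "AE t in lebesgue. (LINT x|lebesgue. \<bar>L (x, t)\<bar> - F (x, t)) \<le> indicator {T..3*T} t * K"
      using AE_integrable_lebesgue_slice[OF L] AE_integrable_lebesgue_slice[OF F]
    proof eventually_elim
      case (elim t)
      show ?case
      proof (cases "t \<in> {T..3*T}")
        case False
        then have "time_cutoff (R\<^sup>2) t = 0" using time_cutoff_eq_0[OF T] by (simp add: T_def)
        \<comment> \<open>Where the time factor vanishes, the heat bound itself forces the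
          differential expression to be 0, as \<open>0 powr (1 / p)\<close> is 0.\<close>
        then have "L (x, t) = 0" "F (x, t) = 0" for x
          using heat[of x t] by (auto simp: L_def F_def H_def cutoff_def)
        then show ?thesis using False by simp
      next
        case True
        have ind: "indicator Q (x, t) = (1::real)" for x
          using True T by (simp add: Q_def)
        have Ft: "F (x, t) = Lq_norm q (\<lambda>x. u x t) powr \<alpha> * \<bar>u x t\<bar> powr p * (space_cutoff R x * time_cutoff (R\<^sup>2) t)" for x
          by (simp add: F_def ind nonlinear_term_def cutoff_def)
        have "(LINT x|lebesgue. \<bar>L (x, t)\<bar> - F (x, t)) \<le> K"
          unfolding K_def Ft
        proof (rule integral_slice_le[OF pq])
          show "emeasure lebesgue (ball (0::'a) R) < \<infinity>" "measure lebesgue (ball (0::'a) R) > 0"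
            using R emeasure_lborel_ball_finite[of "0::'a" R] by simp_all
          show "space_cutoff R \<in> borel_measurable (lebesgue :: 'a measure)"
            by (intro measurable_completion) (simp add: borel_measurable_continuous_onI continuous_on_space_cutoff)
          show "space_cutoff R x = 0" if "x \<notin> ball 0 R" for x :: 'a
            using space_cutoff_eq_0[OF R that] .
          show "\<bar>L (x, t)\<bar> \<le> C / R\<^sup>2 * (\<bar>u x t\<bar> * (space_cutoff R x powr (1 / p) * time_cutoff (R\<^sup>2) t powr (1 / p)))" for x
            using mult_left_mono[OF heat[of x t] abs_ge_zero[of "u x t"]]
            by (simp add: L_def ind H_def abs_mult mult_ac)
          show "integrable lebesgue (\<lambda>x. Lq_norm q (\<lambda>x. u x t) powr \<alpha> * \<bar>u x t\<bar> powr p * (space_cutoff R x * time_cutoff (R\<^sup>2) t))"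
            using elim(3) by (simp add: Ft)
        qed (use elim True C in \<open>simp_all add: space_cutoff_le_1 time_cutoff_le_1\<close>)
        then show ?thesis using True by simp
      qed
    qed
  qed
  also have "\<dots> = 2 * T * K" using T by simp
  finally have W: "W \<le> 2 * T * K" .
  have [measurable]: "(space_cutoff R :: 'a \<Rightarrow> real) \<in> borel_measurable borel"
    by (rule borel_measurable_continuous_onI[OF continuous_on_space_cutoff])
  note [measurable] = borel_measurable_integrable[OF w]
  have wi: "integrable lborel (\<lambda>x. w x * space_cutoff R x)"
  proof (rule Bochner_Integration.integrable_bound[OF w])
    show "AE x in lborel. norm (w x * space_cutoff R x) \<le> norm (w x)"
      by (auto simp: abs_mult intro!: mult_left_le space_cutoff_le_1)
  qed measurable
  \<comment> \<open>Assigning the indicator of positive times to the time factor makes the source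
    integrand a tensor product.\<close>
  have "W = (LINT z|lebesgue. (w (fst z) * space_cutoff R (fst z)) * (indicator {0<..} (snd z) * (snd z powr \<rho> * time_cutoff (R\<^sup>2) (snd z))))"
    unfolding W_def set_lebesgue_integral_def
    by (intro Bochner_Integration.integral_cong) (auto simp: Q_def cutoff_def indicator_def)
  also have "\<dots> = (LINT x|lborel. w x * space_cutoff R x) * (LINT t|lborel. indicator {0<..} t * (t powr \<rho> * time_cutoff (R\<^sup>2) t))"
    using T by (intro integral_lebesgue_tensor wi integral_time_cutoff_ge \<rho>) (simp add: T_def)
  finally show ?thesis using W by (simp add: K_def T_def)
qed

section \<open>Nonexistence below the critical exponent\<close>

theorem theorem1p3:
  fixes N :: nat and p q \<alpha> \<rho> \<delta> :: real and w :: "real ^ 'n \<Rightarrow> real"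
  assumes "CARD('n) = N" and "N \<ge> 3"
    and "p > 1" and "q \<ge> 1" and "\<alpha> \<ge> 0" and "-1 < \<rho>" and "\<rho> \<le> 0"
    and "\<delta> = \<alpha> * (1 - 1 / q)" and "\<delta> < 2 / real N"
    and "continuous_on UNIV w" and "integrable lebesgue w"
    and "(INF (l, x)\<in>{0<..} \<times> UNIV. LINT y|lebesgue. exp (- (norm (x - y))\<^sup>2 / l) * w y) \<ge> (0::real)"
    and "(LINT x|lebesgue. w x) > 0"
    and "p + real N * \<delta> / (real N - 2 * \<rho> - 2) < (real N - 2 * \<rho>) / (real N - 2 * \<rho> - 2)"
  shows "\<not> (\<exists>u0 u. (AE x in lebesgue. 0 \<le> u0 x) \<and> global_weak_solution p q \<alpha> \<rho> w u0 u)"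
proof
  assume "\<exists>u0 u. (AE x in lebesgue. 0 \<le> u0 x) \<and> global_weak_solution p q \<alpha> \<rho> w u0 u"
  then obtain u0 u where u: "global_weak_solution p q \<alpha> \<rho> w u0 u" by blast
  have "w \<in> borel_measurable lborel"
    using borel_measurable_continuous_onI[OF \<open>continuous_on UNIV w\<close>] by simp
  then have w: "integrable lborel w" "(LINT x|lborel. w x) > 0"
    using assms by (simp_all add: integrable_completion integral_completion)
  \<comment> \<open>The exponent -\<sigma> is that of the ball's measure in the slice estimate; r is
    the exponent left by the absorption.\<close>
  define \<sigma> where "\<sigma> = p + \<delta> - 1"
  define r where "r = 1 / (p + \<alpha> - 1)"
  define I where "I = bump 1 * (LINT x|lborel. w x)"
  define V where "V = unit_ball_vol N"
  have I: "I > 0" using w by (simp add: I_def bump_pos)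
  obtain C where C: "C > 0" "\<And>R (x::real^'n) t. R > 0 \<Longrightarrow>
     \<bar>- deriv (\<lambda>s. cutoff R (x, s)) t - laplacian (\<lambda>y. cutoff R (y, t)) x\<bar>
       \<le> C / R\<^sup>2 * (space_cutoff R x powr (1 / p) * time_cutoff (R\<^sup>2) t powr (1 / p))"
    using heat_cutoff_bound[of "1 / p", where ?'a = "real^'n"] \<open>p > 1\<close> by auto
  have "((\<lambda>R. LINT x|lborel. w x * space_cutoff R x) \<longlongrightarrow> I) at_top"
    unfolding I_def by (rule tendsto_integral_space_cutoff[OF w(1)])
  \<comment> \<open>The limit is positive, so the spatial source factor eventually exceeds half of
    it.\<close>
  then have ev: "\<forall>\<^sub>F R in at_top. I / 2 < (LINT x|lborel. w x * space_cutoff R x)"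
    using I by (intro order_tendstoD) auto
  show False
  proof (rule scaling_contradiction)
    show "\<forall>\<^sub>F R in at_top. I / 2 * bump (3 / 4) * (R\<^sup>2 * (3 * R\<^sup>2) powr \<rho>)
        \<le> 2 * R\<^sup>2 * (C / R\<^sup>2 * (C / R\<^sup>2 / (V * R ^ N) powr (- \<sigma>)) powr r)"
      using ev eventually_gt_at_top[of "0::real"]
    proof eventually_elim
      case (elim R)
      have "I / 2 * (R\<^sup>2 * ((3 * R\<^sup>2) powr \<rho> * bump (3 / 4))) \<le>
         (LINT x|lborel. w x * space_cutoff R x) * (LINT t|lborel. indicator {0<..} t * (t powr \<rho> * time_cutoff (R\<^sup>2) t))"
        using elim I \<open>\<rho> \<le> 0\<close> by (intro mult_mono integral_time_cutoff_ge) auto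
      also have "\<dots> \<le> 2 * R\<^sup>2 * (C / R\<^sup>2 * (C / R\<^sup>2 /
          measure lebesgue (ball (0::real^'n) R) powr (1 - p - \<alpha> * (1 - 1 / q))) powr (1 / (p + \<alpha> - 1)))"
        using elim assms C w u by (intro global_weak_solution_source_bound) auto
      also have "measure lebesgue (ball (0::real^'n) R) = V * R ^ N"
        using elim \<open>CARD('n) = N\<close> by (simp add: content_ball V_def)
      also have "1 - p - \<alpha> * (1 - 1 / q) = - \<sigma>"
        using \<open>\<delta> = _\<close> by (simp add: \<sigma>_def)
      finally show ?case by (simp add: r_def mult_ac)
    qed
    \<comment> \<open>Clearing the positive denominator turns the subcriticality hypothesis into
      N\<sigma> - 2 < (2\<rho>+2)(p-1).\<close>
    define d where "d = real N - 2 * \<rho> - 2"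
    have "d > 0" using \<open>N \<ge> 3\<close> \<open>\<rho> \<le> 0\<close> by (simp add: d_def)
    moreover have "p + real N * \<delta> / d < (real N - 2 * \<rho>) / d"
      using assms(14) by (simp add: d_def)
    ultimately have "p * d + real N * \<delta> < real N - 2 * \<rho>"
      by (simp add: pos_less_divide_eq distrib_right)
    then have "p * (real N - 2 * \<rho> - 2) + real N * \<delta> < real N - 2 * \<rho>"
      by (simp add: d_def)
    then have "real N * \<sigma> - 2 < (2 * \<rho> + 2) * (p - 1)"
      by (simp add: \<sigma>_def algebra_simps)
    \<comment> \<open>As 2\<rho>+2 > 0, the nonlocal exponent \<alpha> only enlarges the right side;
      p + \<alpha> - 1 is 1/r, which gives the exponent condition.\<close>
    also have "\<dots> \<le> (2 * \<rho> + 2) * (p + \<alpha> - 1)"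
      using \<open>-1 < \<rho>\<close> \<open>\<alpha> \<ge> 0\<close> by (intro mult_left_mono) auto
    finally show "(real N * \<sigma> - 2) * r < 2 * \<rho> + 2"
      using \<open>p > 1\<close> \<open>\<alpha> \<ge> 0\<close> by (simp add: r_def field_simps)
  qed (use I C \<open>p > 1\<close> \<open>\<alpha> \<ge> 0\<close> in \<open>auto simp: r_def V_def bump_pos\<close>)
qed

end
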